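(* Let $X=\{P_1,\dots,P_r\}$ be a set of $r$ distinct points of $\mathbb P^n_{\mathbf k}\setminus\{x_n=0\}$, not contained in a hyperplane, of socle degree $s$, and let $L_1,\dots,L_r$ be the associated linear forms, normalized so that the coefficient of $y_n$ in each $L_i$ is $1$. Let $I(X)^\perp$ be generated by the family $\mathcal F=\{F_t;\ t\ge1\}$ where $$F_t:=\frac1{(t+s-1)!}\sum_{i=1}^r\alpha_iL_i^{t+s-1}$$ with $\alpha_1,\dots,\alpha_r\in\mathbf k^*$. Assume that $x_n\circ F_t=F_{t-1}$ for all $t>1$ and $x_n\circ F_1=0$. Then for all $t\ge s$ $$\operatorname{Ann}_R(F_t)\circ F_{t+1}=(I(X)+(x_n))^\perp.$$
   Context: $\mathbf k$ is an algebraically closed field of characteristic zero, $n\ge1$, $R=\mathbf k[x_0,\dots,x_n]$ (standard graded) and $\Gamma=\mathbf k[y_0,\dots,y_n]$. $R$ acts on $\Gamma$ by differentiation: $f\circ g=f(\partial_{y_0},\dots,\partial_{y_n})(g)$, making $\Gamma$ an $R$-module; "generated" means generated as an $R$-module. For an ideal $I\subset R$, $I^\perp=\{G\in\Gamma: I\circ G=0\}$; for $G\in\Gamma$, $\operatorname{Ann}_R(G)=\{g\in R: g\circ G=0\}$; for an ideal $\mathfrak a$, $\mathfrak a\circ G=\{g\circ G: g\in\mathfrak a\}$. $I(X)\subset R$ is the homogeneous ideal of $X$. With $\mathrm{HF}_X(t)=\dim_{\mathbf k}(R/I(X))_t$, the socle degree $s$ of $X$ is the largest $t$ with $\mathrm{HF}_X(t)-\mathrm{HF}_X(t-1)\ne0$,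 equivalently the least $t$ with $\mathrm{HF}_X(t)=r$. The linear form associated to $P=[a_0,\dots,a_n]$ is $L=a_0y_0+\cdots+a_ny_n\in\Gamma$; for points off $\{x_n=0\}$ the representatives are chosen with $a_n=1$. *)

theory Defs
  imports
    "HOL-Library.Poly_Mapping"
    "HOL-Library.Set_Algebras"
    "HOL-Analysis.Finite_Cartesian_Product"
    "HOL-Computational_Algebra.Polynomial"
begin

section \<open>Polynomials and the differentiation action\<close>

text \<open>
  The variables are indexed by a finite type \<open>'v\<close> with \<open>n + 1\<close> elements, so that \<open>n \<ge> 1\<close> reads
  \<open>CARD('v) \<ge> 2\<close>. The same type serves for \<open>R\<close> (variables \<open>x\<^sub>i\<close>) and for \<open>\<Gamma>\<close> (variables \<open>y\<^sub>i\<close>).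
\<close>

type_synonym ('v, 'k) mpoly = "('v \<Rightarrow>\<^sub>0 nat) \<Rightarrow>\<^sub>0 'k"

abbreviation coef :: "('v, 'k::zero) mpoly \<Rightarrow> ('v \<Rightarrow>\<^sub>0 nat) \<Rightarrow> 'k"
  where "coef \<equiv> Poly_Mapping.lookup"

abbreviation monoms :: "('v, 'k::zero) mpoly \<Rightarrow> ('v \<Rightarrow>\<^sub>0 nat) set"
  where "monoms \<equiv> Poly_Mapping.keys"

abbreviation Const :: "'k::zero \<Rightarrow> ('v, 'k) mpoly"
  where "Const c \<equiv> Poly_Mapping.single 0 c"

definition Var :: "'v \<Rightarrow> ('v, 'k::comm_ring_1) mpoly"
  where "Var v = Poly_Mapping.single (Poly_Mapping.single v 1) 1"

text \<open>If \<open>v\<close> does not occur in the monomial \<open>m\<close>, the subtraction truncates but the coefficient is \<open>0\<close>.\<close>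

definition pdiff :: "'v \<Rightarrow> ('v, 'k::comm_ring_1) mpoly \<Rightarrow> ('v, 'k) mpoly"
  where "pdiff v g = (\<Sum>m\<in>monoms g. Poly_Mapping.single (m - Poly_Mapping.single v 1)
           (of_nat (Poly_Mapping.lookup m v) * coef g m))"

text \<open>
  The composite of the operators \<open>pdiff v\<close>, each iterated \<open>m v\<close> times; the order of composition
  is irrelevant by \<open>pdiff_commute\<close> below.
\<close>

definition monom_diff :: "('v::finite \<Rightarrow>\<^sub>0 nat) \<Rightarrow> ('v, 'k::comm_ring_1) mpoly \<Rightarrow> ('v, 'k) mpoly"
  where "monom_diff m g = Finite_Set.fold (\<lambda>v. pdiff v ^^ Poly_Mapping.lookup m v) g UNIV"

definition diff_act :: "('v::finite, 'k::comm_ring_1) mpoly \<Rightarrow> ('v, 'k) mpoly \<Rightarrow> ('v, 'k) mpoly"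
    (infixr \<open>\<odot>\<close> 75)
  where "f \<odot> g = (\<Sum>m\<in>monoms f. Const (coef f m) * monom_diff m g)"

lemma coef_pdiff:
  "coef (pdiff v g) m = of_nat (Suc (Poly_Mapping.lookup m v)) * coef g (m + Poly_Mapping.single v 1)"
proof -
  let ?e = "Poly_Mapping.single v (1::nat)"
  have *: "(of_nat (Poly_Mapping.lookup k v) * coef g k when k - ?e = m) =
      (of_nat (Suc (Poly_Mapping.lookup m v)) * coef g (m + ?e) when k = m + ?e)" for k
  proof (cases "Poly_Mapping.lookup k v = 0")
    case True
    then have "k \<noteq> m + ?e" by (auto simp: lookup_add)
    then show ?thesis using True by simp
  next
    case False
    have "k - ?e + ?e = k"
    proof (rule poly_mapping_eqI)
      fix i
      show "Poly_Mapping.lookup (k - ?e + ?e) i = Poly_Mapping.lookup k i"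
        using False by (cases "i = v") (auto simp: lookup_add lookup_minus lookup_single)
    qed
    then have iff: "k - ?e = m \<longleftrightarrow> k = m + ?e"
      by (metis add_diff_cancel_right')
    show ?thesis
    proof (cases "k = m + ?e")
      case True
      then have "Poly_Mapping.lookup k v = Suc (Poly_Mapping.lookup m v)"
        by (simp add: lookup_add)
      then show ?thesis using iff True by simp
    next
      case False
      then show ?thesis using iff by simp
    qed
  qed
  have "coef (pdiff v g) m =
      (\<Sum>k\<in>monoms g. of_nat (Poly_Mapping.lookup k v) * coef g k when k - ?e = m)"
    by (simp add: pdiff_def lookup_sum lookup_single)
  also have "\<dots> = (\<Sum>k\<in>monoms g. of_nat (Suc (Poly_Mapping.lookup m v)) * coef g (m + ?e) when k = m + ?e)"
    using * by simp
  also have "\<dots> = of_nat (Suc (Poly_Mapping.lookup m v)) * coef g (m + ?e)"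
    by (auto simp: when_def sum.delta in_keys_iff)
  finally show ?thesis .
qed

lemma pdiff_commute: "pdiff v (pdiff w g) = pdiff w (pdiff v g)"
  by (rule poly_mapping_eqI, cases "v = w")
    (simp_all add: coef_pdiff lookup_add lookup_single ac_simps)

lemma pdiff_add: "pdiff v (g + h) = pdiff v g + pdiff v h"
  by (rule poly_mapping_eqI) (simp add: coef_pdiff lookup_add algebra_simps)

lemma coef_Const_mult: "coef (Const c * g) m = c * coef g m"
proof -
  have "coef (Const c * g) m = coef (Poly_Mapping.map ((*) c) g) m"
    by (simp add: mult_map_scale_conv_mult)
  also have "\<dots> = c * coef g m"
    by (simp add: map.rep_eq when_def)
  finally show ?thesis .
qed

lemma pdiff_Const_mult: "pdiff v (Const c * g) = Const c * pdiff v g"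
  by (rule poly_mapping_eqI) (simp only: coef_pdiff coef_Const_mult mult.left_commute)

lemma pdiff_pow_commute: "(pdiff v ^^ i) ((pdiff w ^^ j) g) = (pdiff w ^^ j) ((pdiff v ^^ i) g)"
proof -
  have *: "(pdiff v ^^ i) (pdiff w h) = pdiff w ((pdiff v ^^ i) h)" for h
    by (induction i arbitrary: h) (simp_all add: pdiff_commute)
  show ?thesis by (induction j arbitrary: g) (simp_all add: *)
qed

lemma pdiff_pow_linear:
  "(pdiff v ^^ i) (g + h) = (pdiff v ^^ i) g + (pdiff v ^^ i) h"
  "(pdiff v ^^ i) (Const c * g) = Const c * (pdiff v ^^ i) g"
  by (induction i) (simp_all add: pdiff_add pdiff_Const_mult)

lemma comp_fun_commute_pdiff:
  "comp_fun_commute (\<lambda>v. pdiff v ^^ Poly_Mapping.lookup m v)"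
  by standard (simp add: fun_eq_iff pdiff_pow_commute)

lemma monom_diff_linear:
  "monom_diff m (g + h) = monom_diff m g + monom_diff m h"
  "monom_diff m (Const c * g) = Const c * monom_diff m g"
proof -
  interpret comp_fun_commute "\<lambda>v. pdiff v ^^ Poly_Mapping.lookup m v"
    by (rule comp_fun_commute_pdiff)
  let ?F = "\<lambda>g A. Finite_Set.fold (\<lambda>v. pdiff v ^^ Poly_Mapping.lookup m v) g A"
  have "?F (g + h) A = ?F g A + ?F h A" "?F (Const c * g) A = Const c * ?F g A"
    if "finite A" for A
    using that by (induction A) (simp_all add: pdiff_pow_linear)
  then show "monom_diff m (g + h) = monom_diff m g + monom_diff m h"
    "monom_diff m (Const c * g) = Const c * monom_diff m g"
    by (simp_all add: monom_diff_def)
qed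

lemma pdiff_fold_insert:
  assumes "finite A" "v \<notin> A"
  shows "Finite_Set.fold (\<lambda>v. pdiff v ^^ Poly_Mapping.lookup m v) g (insert v A) =
    (pdiff v ^^ Poly_Mapping.lookup m v) (Finite_Set.fold (\<lambda>v. pdiff v ^^ Poly_Mapping.lookup m v) g A)"
proof -
  interpret comp_fun_commute "\<lambda>v. pdiff v ^^ Poly_Mapping.lookup m v"
    by (rule comp_fun_commute_pdiff)
  show ?thesis using assms by simp
qed

lemma monom_diff_zero: "monom_diff 0 g = g"
proof -
  let ?f = "\<lambda>v. pdiff v ^^ Poly_Mapping.lookup 0 v"
  have "Finite_Set.fold ?f g A = g" if "finite A" for A :: "'a set"
    using that
  proof (induction A)
    case (insert v A)
    then show ?case by (subst pdiff_fold_insert) (auto simp del: lookup_zero simp: lookup_zero[of v])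
  qed simp
  from this[OF finite] show ?thesis unfolding monom_diff_def .
qed

lemma monom_diff_plus: "monom_diff (m + m') g = monom_diff m (monom_diff m' g)"
proof -
  let ?f = "\<lambda>m v. pdiff v ^^ Poly_Mapping.lookup m v"
  have "Finite_Set.fold (?f (m + m')) g A = Finite_Set.fold (?f m) (Finite_Set.fold (?f m') g A) A"
    if "finite A" for A :: "'a set"
    using that
  proof (induction A)
    case (insert v A)
    have comm: "Finite_Set.fold (?f m) ((pdiff v ^^ j) h) A = (pdiff v ^^ j) (Finite_Set.fold (?f m) h A)"
      for j h
      using insert(1)
    proof (induction A)
      case (insert w A)
      then show ?case
        by (simp add: pdiff_fold_insert pdiff_pow_commute)
    qed simp
    show ?case
      by (simp only: pdiff_fold_insert[OF insert(1,2)] insert.IH comm)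
         (simp add: lookup_add funpow_add)
  qed simp
  then show ?thesis by (simp add: monom_diff_def)
qed

lemma diff_act_superset:
  assumes "finite S" "monoms f \<subseteq> S"
  shows "f \<odot> g = (\<Sum>m\<in>S. Const (coef f m) * monom_diff m g)"
  unfolding diff_act_def using assms
  by (intro sum.mono_neutral_left) (auto simp: in_keys_iff)

lemma diff_act_add_left: "(f + g) \<odot> h = f \<odot> h + g \<odot> h"
proof -
  let ?S = "monoms f \<union> monoms g"
  have "monoms (f + g) \<subseteq> ?S" by (rule Poly_Mapping.keys_add)
  then show ?thesis
    by (simp add: diff_act_superset[of ?S] lookup_add single_add distrib_right sum.distrib)
qed

lemma diff_act_add_right: "f \<odot> (g + h) = f \<odot> g + f \<odot> h"
  by (simp add: diff_act_def monom_diff_linear distrib_left sum.distrib)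

lemma diff_act_zero_left: "0 \<odot> g = 0"
  by (simp add: diff_act_def)

lemma diff_act_zero_right: "f \<odot> 0 = 0"
  using diff_act_add_right[of f 0 0] by simp

lemma diff_act_single: "Poly_Mapping.single m c \<odot> g = Const c * monom_diff m g"
  by (subst diff_act_superset[of "{m}"]) auto

lemma diff_act_sum_left: "(\<Sum>i\<in>A. f i) \<odot> g = (\<Sum>i\<in>A. f i \<odot> g)"
  by (induction A rule: infinite_finite_induct) (simp_all add: diff_act_zero_left diff_act_add_left)

lemma diff_act_sum_right: "f \<odot> (\<Sum>i\<in>A. g i) = (\<Sum>i\<in>A. f \<odot> g i)"
  by (induction A rule: infinite_finite_induct) (simp_all add: diff_act_zero_right diff_act_add_right)

lemma mpoly_expand: "f = (\<Sum>m\<in>monoms f. Poly_Mapping.single m (coef f m))"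
  by (rule poly_mapping_eqI) (simp add: lookup_sum lookup_single when_def sum.delta in_keys_iff)

lemma diff_act_mult: "(f * g) \<odot> h = f \<odot> (g \<odot> h)"
proof -
  have 1: "(Poly_Mapping.single m a * Poly_Mapping.single m' b) \<odot> h =
      Poly_Mapping.single m a \<odot> (Poly_Mapping.single m' b \<odot> h)" for m m' a b
    by (simp add: mult_single diff_act_single monom_diff_linear monom_diff_plus
        flip: mult.assoc)
  have "(f * g) \<odot> h = ((\<Sum>m\<in>monoms f. Poly_Mapping.single m (coef f m)) *
      (\<Sum>m\<in>monoms g. Poly_Mapping.single m (coef g m))) \<odot> h"
    by (simp flip: mpoly_expand)
  also have "\<dots> = (\<Sum>m\<in>monoms f. Poly_Mapping.single m (coef f m)) \<odot>
      ((\<Sum>m\<in>monoms g. Poly_Mapping.single m (coef g m)) \<odot> h)"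
    by (simp only: sum_product diff_act_sum_left diff_act_sum_right 1, rule sum.swap)
  also have "\<dots> = f \<odot> (g \<odot> h)"
    by (simp flip: mpoly_expand)
  finally show ?thesis .
qed

lemma diff_act_one: "1 \<odot> g = g"
  using diff_act_single[of 0 1 g] by (simp add: monom_diff_zero)

lemma module_diff_act: "module ((\<odot>) :: ('v::finite, 'k::comm_ring_1) mpoly \<Rightarrow> _ \<Rightarrow> _)"
  by standard (simp_all add: diff_act_add_right diff_act_add_left diff_act_mult diff_act_one)

lemma module_mpoly_mult: "module ((*) :: ('v, 'k::comm_ring_1) mpoly \<Rightarrow> _ \<Rightarrow> _)"
  by unfold_locales (rule distrib_left distrib_right mult.assoc[symmetric] mult_1_left)+

lemma vector_space_mpoly: "vector_space (\<lambda>(c::'k::field) (g::('v, 'k) mpoly). Const c * g)"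
proof
  fix c d :: 'k and g h :: "('v, 'k) mpoly"
  show "Const c * (g + h) = Const c * g + Const c * h" by (rule distrib_left)
  show "Const (c + d) * g = Const c * g + Const d * g" by (simp only: single_add distrib_right)
  show "Const c * (Const d * g) = Const (c * d) * g"
    by (simp only: mult.assoc[symmetric] mult_single add_0)
  show "Const 1 * g = g" by simp
qed

definition submodule_gen :: "('v::finite, 'k::comm_ring_1) mpoly set \<Rightarrow> ('v, 'k) mpoly set"
  where "submodule_gen = module.span (\<odot>)"

definition ideal_gen :: "('v, 'k::comm_ring_1) mpoly set \<Rightarrow> ('v, 'k) mpoly set"
  where "ideal_gen = module.span (*)"

definition perp :: "('v::finite, 'k::comm_ring_1) mpoly set \<Rightarrow> ('v, 'k) mpoly set"
  where "perp I = {G. \<forall>f\<in>I. f \<odot> G = 0}"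

definition Ann :: "('v::finite, 'k::comm_ring_1) mpoly \<Rightarrow> ('v, 'k) mpoly set"
  where "Ann G = {g. g \<odot> G = 0}"


section \<open>Projective points and their ideals\<close>

text \<open>A point of projective space is the set of all its coordinate vectors.\<close>

definition proj_point :: "'k::field ^ 'v \<Rightarrow> ('k ^ 'v) set"
  where "proj_point a = {c *s a | c. c \<noteq> 0}"

definition proj_space :: "('k::field ^ 'v) set set"
  where "proj_space = {proj_point a | a. a \<noteq> 0}"

definition proj_hyperplane :: "'k::field ^ 'v::finite \<Rightarrow> ('k ^ 'v) set set"
  where "proj_hyperplane c = {P \<in> proj_space. \<forall>a\<in>P. (\<Sum>v\<in>UNIV. c $ v * a $ v) = 0}"

definition eval :: "'k::comm_ring_1 ^ 'v::finite \<Rightarrow> ('v, 'k) mpoly \<Rightarrow> 'k"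
  where "eval a f = (\<Sum>m\<in>monoms f. coef f m * (\<Prod>v\<in>UNIV. (a $ v) ^ Poly_Mapping.lookup m v))"

definition homog :: "nat \<Rightarrow> ('v::finite, 'k::zero) mpoly set"
  where "homog t = {f. \<forall>m\<in>monoms f. (\<Sum>v\<in>UNIV. Poly_Mapping.lookup m v) = t}"

definition vanishing_ideal :: "('k::field ^ 'v::finite) set set \<Rightarrow> ('v, 'k) mpoly set"
  where "vanishing_ideal X =
    ideal_gen {f. (\<exists>d. f \<in> homog d) \<and> (\<forall>P\<in>X. \<forall>a\<in>P. eval a f = 0)}"

definition lin_form :: "'k::comm_ring_1 ^ 'v::finite \<Rightarrow> ('v, 'k) mpoly"
  where "lin_form a = (\<Sum>v\<in>UNIV. Const (a $ v) * Var v)"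


section \<open>Hilbert function and socle degree\<close>

text \<open>
  For subspaces \<open>U\<close>, \<open>W\<close>, the classes modulo \<open>W\<close> of the elements of \<open>B \<subseteq> U\<close> are pairwise distinct
  and form a finite basis of the image of \<open>U\<close> in the quotient by \<open>W\<close>.
\<close>

definition quot_basis ::
  "('v, 'k::field) mpoly set \<Rightarrow> ('v, 'k) mpoly set \<Rightarrow> ('v, 'k) mpoly set \<Rightarrow> bool"
  where "quot_basis U W B \<longleftrightarrow> finite B \<and> B \<subseteq> U \<and>
    (\<forall>u\<in>U. \<exists>!c. (\<forall>b. b \<notin> B \<longrightarrow> c b = 0) \<and> u - (\<Sum>b\<in>B. Const (c b) * b) \<in> W)"

definition quot_dim :: "('v, 'k::field) mpoly set \<Rightarrow> ('v, 'k) mpoly set \<Rightarrow> nat"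
  where "quot_dim U W = (THE d. \<exists>B. quot_basis U W B \<and> card B = d)"

lemma quot_basis_card_le:
  fixes U W :: "('v, 'k::field) mpoly set"
  assumes U: "module.subspace (\<lambda>c g. Const c * g) U" and W: "module.subspace (\<lambda>c g. Const c * g) W"
    and B: "quot_basis U W B" and B': "quot_basis U W B'"
  shows "card B' \<le> card B"
proof -
  interpret vector_space "\<lambda>(c::'k) (g::('v, 'k) mpoly). Const c * g"
    by (rule vector_space_mpoly)
  have fin: "finite B" "finite B'" using B B' by (auto simp: quot_basis_def)
  have "\<forall>u\<in>B'. \<exists>c. u - (\<Sum>b\<in>B. Const (c b) * b) \<in> W"
    using B B' unfolding quot_basis_def by (meson ex1_implies_ex subsetD)
  from bchoice[OF this]
  obtain c where c: "\<And>u. u \<in> B' \<Longrightarrow> u - (\<Sum>b\<in>B. Const (c u b) * b) \<in> W"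
    by blast
  define p where "p u = (\<Sum>b\<in>B. Const (c u b) * b)" for u
  have pW: "u - p u \<in> W" if "u \<in> B'" for u using c[OF that] by (simp add: p_def)
  have EX1: "x = y" if "\<exists>!c. Q c" "Q x" "Q y" for Q and x y :: "('v, 'k) mpoly \<Rightarrow> 'k"
    using that by blast
  have uniq: "d = d'"
    if "u \<in> U" "\<forall>b. b \<notin> B' \<longrightarrow> d b = 0" "\<forall>b. b \<notin> B' \<longrightarrow> d' b = 0"
      "u - (\<Sum>b\<in>B'. Const (d b) * b) \<in> W" "u - (\<Sum>b\<in>B'. Const (d' b) * b) \<in> W" for u d d'
  proof -
    let ?P = "\<lambda>c. (\<forall>b. b \<notin> B' \<longrightarrow> c b = 0) \<and> u - (\<Sum>b\<in>B'. Const (c b) * b) \<in> W"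
    have "\<exists>!c. ?P c" using B' that(1) by (simp add: quot_basis_def)
    moreover have "?P d" "?P d'" using that by simp_all
    ultimately show ?thesis by (rule EX1)
  qed
  have inj: "inj_on p B'"
  proof (rule inj_onI)
    fix u w assume *: "u \<in> B'" "w \<in> B'" "p u = p w"
    have "(u - p u) - (w - p w) \<in> W" using pW * W subspace_diff by blast
    then have "u - w \<in> W" using * by simp
    moreover have "(\<Sum>b\<in>B'. Const ((if b = x then 1 else 0) :: 'k) * b) = x" if "x \<in> B'" for x
    proof -
      have "(\<Sum>b\<in>B'. Const ((if b = x then 1 else 0) :: 'k) * b) = (\<Sum>b\<in>B'. if b = x then b else 0)"
        by (rule sum.cong) auto
      then show ?thesis using that fin by simp
    qed
    ultimately have "u - (\<Sum>b\<in>B'. Const ((if b = u then 1 else 0) :: 'k) * b) \<in> W"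
      "u - (\<Sum>b\<in>B'. Const ((if b = w then 1 else 0) :: 'k) * b) \<in> W"
      using * subspace_0[OF W] by simp_all
    moreover have "u \<in> U" using * B' by (auto simp: quot_basis_def)
    ultimately have "(\<lambda>b. if b = u then 1 else 0 :: 'k) = (\<lambda>b. if b = w then 1 else 0)"
      using * by (intro uniq[of u]) auto
    then show "u = w" by (metis (full_types) zero_neq_one)
  qed
  have "independent (p ` B')"
  proof (rule independent_if_scalars_zero)
    show "finite (p ` B')" using fin by simp
  next
    fix f x assume *: "(\<Sum>x\<in>p ` B'. Const (f x) * x) = 0" "x \<in> p ` B'"
    define d where "d b = (if b \<in> B' then f (p b) else 0)" for b
    have "(\<Sum>b\<in>B'. Const (f (p b)) * p b) = 0" using *(1) inj by (simp add: sum.reindex)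
    moreover have "(\<Sum>b\<in>B'. Const (f (p b)) * (b - p b)) \<in> W"
      using W pW by (intro subspace_sum subspace_scale) auto
    ultimately have "(\<Sum>b\<in>B'. Const (f (p b)) * b) \<in> W"
      by (simp add: right_diff_distrib sum_subtractf)
    then have "0 - (\<Sum>b\<in>B'. Const (d b) * b) \<in> W"
      using subspace_neg[OF W] by (simp add: d_def)
    then have "d = (\<lambda>_. 0)"
      using subspace_0[OF U] subspace_0[OF W] by (intro uniq[of 0]) (auto simp: d_def)
    then show "f x = 0" using *(2) by (auto simp: d_def fun_eq_iff split: if_splits)
  qed
  moreover have "p ` B' \<subseteq> span B"
  proof (rule image_subsetI)
    show "p u \<in> span B" for u
      unfolding p_def by (intro span_sum span_scale span_base)
  qed
  ultimately have "card (p ` B') \<le> card B"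
    using independent_span_bound[OF fin(1)] by blast
  then show ?thesis using inj by (simp add: card_image)
qed

lemma quot_dim_eq_card:
  assumes "module.subspace (\<lambda>c g. Const c * g) U" "module.subspace (\<lambda>c g. Const c * g) W"
    and "quot_basis U W B"
  shows "quot_dim U W = card B"
  unfolding quot_dim_def
proof (rule the_equality)
  show "\<exists>B'. quot_basis U W B' \<and> card B' = card B" using assms(3) by blast
next
  fix d assume "\<exists>B'. quot_basis U W B' \<and> card B' = d"
  then obtain B' where B': "quot_basis U W B'" "card B' = d" by blast
  show "d = card B"
    using quot_basis_card_le[OF assms(1,2) assms(3) B'(1)]
      quot_basis_card_le[OF assms(1,2) B'(1) assms(3)] B'(2) by simp
qed

definition hilbert_fun :: "('k::field ^ 'v::finite) set set \<Rightarrow> nat \<Rightarrow> nat"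
  where "hilbert_fun X t = quot_dim (homog t) (vanishing_ideal X)"

definition hilbert_diff :: "('k::field ^ 'v::finite) set set \<Rightarrow> nat \<Rightarrow> int"
  where "hilbert_diff X t =
    int (hilbert_fun X t) - (if t = 0 then 0 else int (hilbert_fun X (t - 1)))"

definition socle_degree :: "('k::field ^ 'v::finite) set set \<Rightarrow> nat"
  where "socle_degree X = (GREATEST t. hilbert_diff X t \<noteq> 0)"

end

theory Submission
  imports Defs "HOL-Library.Function_Algebras"
begin

text \<open>
  Write \<open>L\<^bsup>[k]\<^esup> = L\<^sup>k / k!\<close>; a form \<open>f\<close> of degree \<open>e\<close> sends \<open>L\<^sub>i\<^bsup>[k]\<^esup>\<close> to \<open>f(P\<^sub>i) L\<^sub>i\<^bsup>[k - e]\<^esup>\<close>.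
  In every degree \<open>d \<ge> s\<close> there are forms taking arbitrary values at the points, because the
  Hilbert function there equals \<open>r\<close>. By the generation hypothesis an element \<open>G\<close> of the right-hand side
  is a combination of the \<open>L\<^sub>i\<^bsup>[d]\<^esup>\<close>, and since \<open>x\<^sub>n\<close> kills \<open>G\<close> only degrees \<open>d \<le> s\<close> occur. A term
  \<open>L\<^sub>i\<^bsup>[d]\<^esup>\<close> is then \<open>q \<circ> F\<^bsub>t+1\<^esub>\<close> for a form \<open>q\<close> of degree \<open>t + s - d \<ge> s\<close> with \<open>q(P\<^sub>i) = 1/\<alpha>\<^sub>i\<close> that
  vanishes at the other points.
  If \<open>G = g \<circ> F\<^bsub>t+1\<^esub>\<close>, then \<open>g \<circ> F\<^sub>t = x\<^sub>n \<circ> G = 0\<close>. The other inclusion is formal.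
\<close>

section \<open>Evaluation and homogeneous polynomials\<close>

lemma eval_superset:
  assumes "finite S" "monoms f \<subseteq> S"
  shows "eval a f = (\<Sum>m\<in>S. coef f m * (\<Prod>v\<in>UNIV. (a $ v) ^ Poly_Mapping.lookup m v))"
  unfolding eval_def using assms
  by (intro sum.mono_neutral_left) (auto simp: in_keys_iff)

lemma eval_single:
  "eval a (Poly_Mapping.single m c) = c * (\<Prod>v\<in>UNIV. (a $ v) ^ Poly_Mapping.lookup m v)"
  by (subst eval_superset[of "{m}"]) auto

lemma eval_zero: "eval a 0 = 0"
  by (simp add: eval_def)

lemma eval_add: "eval a (f + g) = eval a f + eval a g"
proof -
  let ?S = "monoms f \<union> monoms g"
  have "monoms (f + g) \<subseteq> ?S" by (rule Poly_Mapping.keys_add)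
  then show ?thesis
    by (simp add: eval_superset[of ?S] lookup_add distrib_right sum.distrib)
qed

lemma eval_sum: "eval a (\<Sum>i\<in>A. f i) = (\<Sum>i\<in>A. eval a (f i))"
  by (induction A rule: infinite_finite_induct) (simp_all add: eval_zero eval_add)

lemma eval_mult: "eval a (f * g) = eval a f * eval a g"
proof -
  have 1: "eval a (Poly_Mapping.single m c * Poly_Mapping.single m' c') =
      eval a (Poly_Mapping.single m c) * eval a (Poly_Mapping.single m' c')" for m m' c c'
    by (simp add: mult_single eval_single lookup_add power_add prod.distrib)
  have "eval a (f * g) = eval a ((\<Sum>m\<in>monoms f. Poly_Mapping.single m (coef f m)) *
      (\<Sum>m\<in>monoms g. Poly_Mapping.single m (coef g m)))"
    by (simp flip: mpoly_expand)
  also have "\<dots> = eval a (\<Sum>m\<in>monoms f. Poly_Mapping.single m (coef f m)) *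
      eval a (\<Sum>m\<in>monoms g. Poly_Mapping.single m (coef g m))"
    by (simp only: sum_product eval_sum 1)
  also have "\<dots> = eval a f * eval a g"
    by (simp flip: mpoly_expand)
  finally show ?thesis .
qed

lemma eval_Const: "eval a (Const c) = c"
  by (simp add: eval_single)

lemma eval_one: "eval a 1 = 1"
  using eval_Const[of a 1] by simp

lemma eval_Var: "eval a (Var v) = a $ v"
proof -
  have "(\<Prod>w\<in>UNIV. (a $ w) ^ (1 when v = w)) = (\<Prod>w\<in>UNIV. if v = w then a $ w else 1)"
    by (rule prod.cong) (auto simp: when_def)
  then show ?thesis by (simp add: Var_def eval_single lookup_single)
qed

lemma eval_power: "eval a (f ^ k) = eval a f ^ k"
  by (induction k) (simp_all add: eval_one eval_mult)

lemma eval_prod: "eval a (\<Prod>i\<in>A. f i) = (\<Prod>i\<in>A. eval a (f i))"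
  by (induction A rule: infinite_finite_induct) (simp_all add: eval_one eval_mult)

lemma eval_scale:
  assumes "f \<in> homog d"
  shows "eval (c *s a) f = c ^ d * eval a f"
proof -
  have "(\<Prod>v\<in>UNIV. (c * a $ v) ^ Poly_Mapping.lookup m v) =
      c ^ d * (\<Prod>v\<in>UNIV. (a $ v) ^ Poly_Mapping.lookup m v)" if "m \<in> monoms f" for m
    using assms that by (auto simp: homog_def power_mult_distrib prod.distrib simp flip: power_sum)
  then show ?thesis
    by (auto simp: eval_def sum_distrib_left mult.left_commute intro!: sum.cong)
qed

lemma homog_zero: "0 \<in> homog d"
  by (simp add: homog_def)

lemma homog_add: "f \<in> homog d \<Longrightarrow> g \<in> homog d \<Longrightarrow> f + g \<in> homog d"
  using Poly_Mapping.keys_add[of f g] by (auto simp: homog_def)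

lemma homog_mult:
  assumes "f \<in> homog d" "g \<in> homog e"
  shows "f * g \<in> homog (d + e)"
  unfolding homog_def
proof clarify
  fix m assume "m \<in> monoms (f * g)"
  then obtain m1 m2 where "m1 \<in> monoms f" "m2 \<in> monoms g" "m = m1 + m2"
    using keys_mult[of f g] by auto
  then show "(\<Sum>v\<in>UNIV. Poly_Mapping.lookup m v) = d + e"
    using assms by (auto simp: homog_def lookup_add sum.distrib)
qed

lemma homog_Const: "Const c \<in> homog 0"
  by (simp add: homog_def)

lemma homog_one: "(1 :: ('v::finite, 'k::comm_semiring_1) mpoly) \<in> homog 0"
  by (simp add: homog_def)

lemma homog_Const_mult: "f \<in> homog d \<Longrightarrow> Const c * f \<in> homog d"
  using homog_mult[OF homog_Const] by fastforce

lemma homog_sum: "(\<And>i. i \<in> A \<Longrightarrow> f i \<in> homog d) \<Longrightarrow> (\<Sum>i\<in>A. f i) \<in> homog d"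
  by (induction A rule: infinite_finite_induct) (simp_all add: homog_zero homog_add)

lemma homog_Var: "Var v \<in> homog 1"
  by (auto simp: homog_def Var_def lookup_single when_def)

lemma homog_power:
  fixes f :: "('v::finite, 'k::comm_semiring_1) mpoly"
  shows "f \<in> homog d \<Longrightarrow> f ^ k \<in> homog (k * d)"
  by (induction k) (simp_all add: homog_one homog_mult)

lemma homog_prod:
  "(\<And>i. i \<in> A \<Longrightarrow> f i \<in> homog (d i)) \<Longrightarrow> (\<Prod>i\<in>A. f i) \<in> homog (\<Sum>i\<in>A. d i)"
  by (induction A rule: infinite_finite_induct) (simp_all add: homog_one homog_mult)

lemma subspace_homog:
  "module.subspace (\<lambda>(c::'k::field) (g::('v::finite, 'k) mpoly). Const c * g) (homog d)"
proof -
  interpret vector_space "\<lambda>(c::'k) (g::('v, 'k) mpoly). Const c * g"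
    by (rule vector_space_mpoly)
  show ?thesis by (rule subspaceI) (simp_all add: homog_zero homog_add homog_Const_mult)
qed


section \<open>Differentiating powers of linear forms\<close>

lemma pdiff_one: "pdiff v 1 = 0"
  by (simp add: pdiff_def flip: single_one)

lemma pdiff_single:
  "pdiff v (Poly_Mapping.single m c) =
    Poly_Mapping.single (m - Poly_Mapping.single v 1) (of_nat (Poly_Mapping.lookup m v) * c)"
  by (cases "c = 0") (simp_all add: pdiff_def)

lemma pdiff_sum: "pdiff v (\<Sum>i\<in>A. f i) = (\<Sum>i\<in>A. pdiff v (f i))"
proof -
  have "pdiff v 0 = 0" by (simp add: pdiff_def)
  then show ?thesis by (induction A rule: infinite_finite_induct) (simp_all add: pdiff_add)
qed

lemma pdiff_Var_mult: "pdiff v (Var w * g) = (if v = w then g else 0) + Var w * pdiff v g"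
proof -
  let ?e = "\<lambda>v. Poly_Mapping.single v (1::nat)"
  have 1: "pdiff v (Var w * Poly_Mapping.single m c) =
      (if v = w then Poly_Mapping.single m c else 0) + Var w * pdiff v (Poly_Mapping.single m c)" for m c
  proof (cases "v = w")
    case True
    have "?e w + (m - ?e w) = m" if "Poly_Mapping.lookup m w \<noteq> 0"
      using that by (intro poly_mapping_eqI) (auto simp: lookup_add lookup_minus lookup_single when_def)
    then show ?thesis using True
      by (cases "Poly_Mapping.lookup m w = 0")
        (simp_all add: Var_def mult_single pdiff_single lookup_add distrib_right flip: single_add)
  next
    case False
    have "?e w + m - ?e v = ?e w + (m - ?e v)"
      using False by (intro poly_mapping_eqI) (auto simp: lookup_add lookup_minus lookup_single when_def)
    then show ?thesis using False
      by (simp add: Var_def mult_single pdiff_single lookup_add lookup_single)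
  qed
  have "pdiff v (Var w * (\<Sum>m\<in>monoms g. Poly_Mapping.single m (coef g m))) =
    (if v = w then (\<Sum>m\<in>monoms g. Poly_Mapping.single m (coef g m)) else 0) +
    Var w * pdiff v (\<Sum>m\<in>monoms g. Poly_Mapping.single m (coef g m))"
    by (simp add: sum_distrib_left pdiff_sum 1 sum.distrib)
  then show ?thesis by (simp flip: mpoly_expand)
qed

lemma pdiff_lin_form_mult:
  "pdiff v (lin_form a * g) = Const (a $ v) * g + lin_form a * pdiff v g"
proof -
  have "pdiff v (lin_form a * g) = (\<Sum>w\<in>UNIV. Const (a $ w) * pdiff v (Var w * g))"
    by (simp add: lin_form_def sum_distrib_right pdiff_sum mult.assoc pdiff_Const_mult)
  also have "\<dots> = (\<Sum>w\<in>UNIV. (if v = w then Const (a $ w) * g else 0) +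
      Const (a $ w) * Var w * pdiff v g)"
    by (rule sum.cong) (simp_all add: pdiff_Var_mult distrib_left mult.assoc)
  also have "\<dots> = Const (a $ v) * g + lin_form a * pdiff v g"
    by (simp add: sum.distrib lin_form_def sum_distrib_right)
  finally show ?thesis .
qed

lemma pdiff_lin_form_power:
  "pdiff v (lin_form a ^ Suc k) = Const (of_nat (Suc k) * a $ v) * lin_form a ^ k"
proof (induction k)
  case 0
  show ?case using pdiff_lin_form_mult[of v a 1] by (simp add: pdiff_def flip: single_one)
next
  case (Suc k)
  have "pdiff v (lin_form a ^ Suc (Suc k)) =
      Const (a $ v) * lin_form a ^ Suc k + lin_form a * (Const (of_nat (Suc k) * a $ v) * lin_form a ^ k)"
    by (simp only: power_Suc[of _ "Suc k"] pdiff_lin_form_mult Suc)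
  also have "\<dots> = (Const (a $ v) + Const (of_nat (Suc k) * a $ v)) * lin_form a ^ Suc k"
    by (simp add: algebra_simps)
  also have "\<dots> = Const (of_nat (Suc (Suc k)) * a $ v) * lin_form a ^ Suc k"
    by (simp add: algebra_simps flip: single_add)
  finally show ?case .
qed

definition divpow :: "'k::field_char_0 ^ 'v::finite \<Rightarrow> nat \<Rightarrow> ('v, 'k) mpoly"
  where "divpow a k = Const (1 / fact k) * lin_form a ^ k"

lemma Const_mult_Const_mult: "Const b * (Const c * g) = Const (b * c) * g"
  by (simp add: mult_single flip: mult.assoc)

lemma pdiff_divpow:
  fixes a :: "'k::field_char_0 ^ 'v::finite"
  shows "pdiff v (divpow a k) = (if k = 0 then 0 else Const (a $ v) * divpow a (k - 1))"
proof (cases k)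
  case 0
  then show ?thesis by (simp add: divpow_def pdiff_one)
next
  case (Suc j)
  have "1 / fact (Suc j) * (of_nat (Suc j) * a $ v) = a $ v * (1 / fact j)"
    by (simp del: of_nat_Suc)
  then show ?thesis
    by (simp only: Suc divpow_def pdiff_Const_mult pdiff_lin_form_power Const_mult_Const_mult) simp
qed

lemma pdiff_pow_divpow:
  fixes a :: "'k::field_char_0 ^ 'v::finite"
  shows "(pdiff v ^^ j) (divpow a k) = (if j \<le> k then Const (a $ v ^ j) * divpow a (k - j) else 0)"
proof (induction j)
  case (Suc j)
  have "pdiff v 0 = (0 :: ('v, 'k) mpoly)" by (simp add: pdiff_def)
  then show ?case
    using Suc by (auto simp: pdiff_Const_mult pdiff_divpow Const_mult_Const_mult mult.commute[of "a $ v"])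
qed simp

lemma monom_diff_divpow:
  fixes a :: "'k::field_char_0 ^ 'v::finite"
  shows "monom_diff m (divpow a k) =
    (if (\<Sum>v\<in>UNIV. Poly_Mapping.lookup m v) \<le> k
     then Const (\<Prod>v\<in>UNIV. (a $ v) ^ Poly_Mapping.lookup m v) *
       divpow a (k - (\<Sum>v\<in>UNIV. Poly_Mapping.lookup m v))
     else 0)"
proof -
  have z: "(pdiff v ^^ j) 0 = (0 :: ('v, 'k) mpoly)" for v j
    by (induction j) (simp_all add: pdiff_def)
  have "Finite_Set.fold (\<lambda>v. pdiff v ^^ Poly_Mapping.lookup m v) (divpow a k) A =
    (if (\<Sum>v\<in>A. Poly_Mapping.lookup m v) \<le> k
     then Const (\<Prod>v\<in>A. (a $ v) ^ Poly_Mapping.lookup m v) *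
       divpow a (k - (\<Sum>v\<in>A. Poly_Mapping.lookup m v))
     else 0)" if "finite A" for A
    using that
  proof (induction A)
    case (insert v A)
    then show ?case
      by (auto simp: pdiff_fold_insert pdiff_pow_linear pdiff_pow_divpow z Const_mult_Const_mult
          mult.commute[of "a $ v ^ Poly_Mapping.lookup m v"] add.commute[of "Poly_Mapping.lookup m v"])
  qed simp
  from this[OF finite] show ?thesis unfolding monom_diff_def .
qed

lemma diff_act_divpow:
  fixes a :: "'k::field_char_0 ^ 'v::finite"
  assumes "f \<in> homog e"
  shows "f \<odot> divpow a k = (if e \<le> k then Const (eval a f) * divpow a (k - e) else 0)"
proof -
  have "f \<odot> divpow a k = (\<Sum>m\<in>monoms f. if e \<le> k then
      Const (coef f m * (\<Prod>v\<in>UNIV. (a $ v) ^ Poly_Mapping.lookup m v)) * divpow a (k - e) else 0)"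
    unfolding diff_act_def using assms
    by (intro sum.cong) (auto simp: monom_diff_divpow homog_def Const_mult_Const_mult)
  also have "\<dots> = (if e \<le> k then Const (eval a f) * divpow a (k - e) else 0)"
  proof -
    have "Const (\<Sum>m\<in>S. h m) = (\<Sum>m\<in>S. Const (h m) :: ('v, 'k) mpoly)"
      for S and h :: "('v \<Rightarrow>\<^sub>0 nat) \<Rightarrow> 'k"
      by (induction S rule: infinite_finite_induct) (simp_all add: single_add)
    then have "Const (eval a f) = (\<Sum>m\<in>monoms f.
        Const (coef f m * (\<Prod>v\<in>UNIV. (a $ v) ^ Poly_Mapping.lookup m v)) :: ('v, 'k) mpoly)"
      unfolding eval_def .
    then show ?thesis by (simp add: sum_distrib_right)
  qed
  finally show ?thesis .
qed

lemma diff_act_Const_mult_left: "(Const c * f) \<odot> g = Const c * (f \<odot> g)"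
  by (simp add: diff_act_mult diff_act_single monom_diff_zero)

lemma diff_act_Const_mult_right: "f \<odot> (Const c * g) = Const c * (f \<odot> g)"
  by (metis diff_act_Const_mult_left diff_act_mult diff_act_single monom_diff_zero mult.commute)

lemma homog_divpow: "divpow a k \<in> homog k"
proof -
  have "lin_form a \<in> homog 1"
    unfolding lin_form_def by (intro homog_sum homog_Const_mult homog_Var)
  from homog_power[OF this, of k] show ?thesis
    unfolding divpow_def by (intro homog_Const_mult) simp
qed

lemma coef_divpow_zero: "coef (divpow a k) 0 = (if k = 0 then 1 else 0)"
proof (cases k)
  case (Suc j)
  then have "0 \<notin> monoms (divpow a k)"
    using homog_divpow[of a k] by (auto simp: homog_def)
  then show ?thesis using Suc by (simp add: in_keys_iff)
qed (simp add: divpow_def)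


section \<open>The Hilbert function of a set of points\<close>

lemma (in vector_space) quot_dim_eq_dim_image:
  fixes \<phi> :: "('v, 'a) mpoly \<Rightarrow> 'b"
  assumes add: "\<And>f g. \<phi> (f + g) = \<phi> f + \<phi> g"
    and scale: "\<And>c f. \<phi> (Const c * f) = scale c (\<phi> f)"
    and U: "module.subspace (\<lambda>c g. Const c * g) U"
    and W: "module.subspace (\<lambda>c g. Const c * g) W"
    and ker: "\<And>u. u \<in> U \<Longrightarrow> u \<in> W \<longleftrightarrow> \<phi> u = 0"
    and T: "finite T" "\<phi> ` U \<subseteq> span T"
  shows "quot_dim U W = dim (\<phi> ` U)"
proof -
  interpret mp: vector_space "\<lambda>(c::'a) (g::('v, 'a) mpoly). Const c * g"
    by (rule vector_space_mpoly)
  have zero: "\<phi> 0 = 0" using add[of 0 0] by simp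
  have diff: "\<phi> (f - g) = \<phi> f - \<phi> g" for f g
    using add[of "f - g" g] by (simp add: algebra_simps)
  have sum: "\<phi> (\<Sum>x\<in>A. h x) = (\<Sum>x\<in>A. \<phi> (h x))" for A and h :: "('v, 'a) mpoly \<Rightarrow> ('v, 'a) mpoly"
    by (induction A rule: infinite_finite_induct) (simp_all add: zero add)
  obtain B0 where B0: "B0 \<subseteq> \<phi> ` U" "independent B0" "\<phi> ` U \<subseteq> span B0" "card B0 = dim (\<phi> ` U)"
    by (rule basis_exists)
  have fin: "finite B0"
    using independent_span_bound[OF T(1) B0(2)] B0(1) T(2) by blast
  have "\<forall>b\<in>B0. \<exists>u. u \<in> U \<and> \<phi> u = b" using B0(1) by blast
  then obtain l where l: "\<And>b. b \<in> B0 \<Longrightarrow> l b \<in> U" "\<And>b. b \<in> B0 \<Longrightarrow> \<phi> (l b) = b"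
    by (metis (no_types))
  define B where "B = l ` B0"
  have inj: "inj_on l B0" by (rule inj_on_inverseI[of _ \<phi>]) (rule l(2))
  have BU: "B \<subseteq> U" using l(1) by (auto simp: B_def)
  have phi_comb: "\<phi> (\<Sum>b\<in>B. Const (c b) * b) = (\<Sum>b\<in>B0. scale (c (l b)) b)" for c
  proof -
    have "\<phi> (\<Sum>b\<in>B. Const (c b) * b) = (\<Sum>b\<in>B. scale (c b) (\<phi> b))"
      by (simp add: sum scale)
    also have "\<dots> = (\<Sum>b\<in>B0. scale (c (l b)) (\<phi> (l b)))"
      using inj by (simp add: B_def sum.reindex)
    also have "\<dots> = (\<Sum>b\<in>B0. scale (c (l b)) b)" by (rule sum.cong) (simp_all add: l(2))
    finally show ?thesis .
  qed
  have memW: "u - (\<Sum>b\<in>B. Const (c b) * b) \<in> W \<longleftrightarrow> \<phi> u = (\<Sum>b\<in>B0. scale (c (l b)) b)"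
    if "u \<in> U" for u c
  proof -
    have "u - (\<Sum>b\<in>B. Const (c b) * b) \<in> U"
      using that BU by (intro mp.subspace_diff[OF U] mp.subspace_sum[OF U] mp.subspace_scale[OF U]) auto
    from ker[OF this] show ?thesis by (simp add: diff phi_comb)
  qed
  have "quot_basis U W B"
    unfolding quot_basis_def
  proof (intro conjI ballI)
    show "finite B" using fin by (simp add: B_def)
    show "B \<subseteq> U" by (rule BU)
    fix u assume u: "u \<in> U"
    then have "\<phi> u \<in> span B0" using B0(3) by blast
    then obtain d where d: "\<phi> u = (\<Sum>b\<in>B0. scale (d b) b)"
      using span_finite[OF fin] by auto
    show "\<exists>!c. (\<forall>b. b \<notin> B \<longrightarrow> c b = 0) \<and> u - (\<Sum>b\<in>B. Const (c b) * b) \<in> W"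
    proof (rule ex1I)
      let ?c = "\<lambda>x. if x \<in> B then d (\<phi> x) else 0"
      have "(\<Sum>b\<in>B0. scale (d b) b) = (\<Sum>b\<in>B0. scale (?c (l b)) b)"
        by (rule sum.cong) (simp_all add: B_def l(2))
      then show "(\<forall>b. b \<notin> B \<longrightarrow> ?c b = 0) \<and> u - (\<Sum>b\<in>B. Const (?c b) * b) \<in> W"
        using memW[OF u, of ?c] d by simp
    next
      fix c assume c: "(\<forall>b. b \<notin> B \<longrightarrow> c b = 0) \<and> u - (\<Sum>b\<in>B. Const (c b) * b) \<in> W"
      have "(\<Sum>b\<in>B0. scale (c (l b) - d b) b) = 0"
        using c memW[OF u, of c] d by (simp add: scale_left_diff_distrib sum_subtractf)
      from independentD[OF B0(2) fin subset_refl this] have "c (l b) = d b" if "b \<in> B0" for b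
        using that by simp
      then show "c = (\<lambda>x. if x \<in> B then d (\<phi> x) else 0)"
        using c by (auto simp: B_def l(2) fun_eq_iff)
    qed
  qed
  then have "quot_dim U W = card B" by (rule quot_dim_eq_card[OF U W])
  then show ?thesis using B0(4) inj by (simp add: B_def card_image)
qed

lemma sum_apply: "(\<Sum>j\<in>A. h j) i = (\<Sum>j\<in>A. h j i)"
  by (induction A rule: infinite_finite_induct) simp_all

lemma vector_space_fun: "vector_space (\<lambda>(c::'k::field) (f::'i \<Rightarrow> 'k) i. c * f i)"
  by standard (auto simp: algebra_simps)

locale affine_points =
  fixes z :: "'v::finite" and J :: "'i set" and a :: "'i \<Rightarrow> 'k::field ^ 'v"
  assumes finite_J: "finite J"
    and last_coord: "i \<in> J \<Longrightarrow> a i $ z = 1"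
    and inj_a: "inj_on a J"
begin

sublocale fv: vector_space "\<lambda>(c::'k) (f::'i \<Rightarrow> 'k) i. c * f i"
  by (rule vector_space_fun)

definition points :: "('k ^ 'v) set set"
  where "points = (\<lambda>i. proj_point (a i)) ` J"

definition eval_vec :: "('v, 'k) mpoly \<Rightarrow> 'i \<Rightarrow> 'k"
  where "eval_vec f = (\<lambda>i. if i \<in> J then eval (a i) f else 0)"

definition unit_vec :: "'i \<Rightarrow> 'i \<Rightarrow> 'k"
  where "unit_vec j = (\<lambda>i. if i = j then 1 else 0)"

definition separated :: "nat \<Rightarrow> bool"
  where "separated d \<longleftrightarrow> (\<forall>j\<in>J. \<exists>g\<in>homog d. \<forall>i\<in>J. eval (a i) g = (if i = j then 1 else 0))"

lemma homog_in_vanishing_ideal_iff: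
  assumes "f \<in> homog d"
  shows "f \<in> vanishing_ideal points \<longleftrightarrow> (\<forall>i\<in>J. eval (a i) f = 0)"
proof
  interpret module "(*) :: ('v, 'k) mpoly \<Rightarrow> _" by (rule module_mpoly_mult)
  assume "f \<in> vanishing_ideal points"
  moreover have "eval (a i) f = 0" if "i \<in> J"
    "f \<in> span {f. (\<exists>d. f \<in> homog d) \<and> (\<forall>P\<in>points. \<forall>a\<in>P. eval a f = 0)}" for i
    using that(2)
  proof (induction rule: span_induct_alt)
    case base
    show ?case by (rule eval_zero)
  next
    case (step c x y)
    have "a i \<in> proj_point (a i)" by (auto simp: proj_point_def intro!: exI[of _ 1])
    then show ?case using step that(1) by (auto simp: eval_add eval_mult points_def)
  qed
  ultimately show "\<forall>i\<in>J. eval (a i) f = 0"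
    by (simp add: vanishing_ideal_def ideal_gen_def)
next
  interpret module "(*) :: ('v, 'k) mpoly \<Rightarrow> _" by (rule module_mpoly_mult)
  assume "\<forall>i\<in>J. eval (a i) f = 0"
  then show "f \<in> vanishing_ideal points"
    unfolding vanishing_ideal_def ideal_gen_def using assms
    by (intro span_base) (auto simp: points_def proj_point_def eval_scale)
qed

lemma subspace_vanishing_ideal:
  "module.subspace (\<lambda>c g. Const c * g) (vanishing_ideal points)"
proof -
  interpret m: module "(*) :: ('v, 'k) mpoly \<Rightarrow> _" by (rule module_mpoly_mult)
  interpret v: vector_space "\<lambda>(c::'k) (g::('v, 'k) mpoly). Const c * g"
    by (rule vector_space_mpoly)
  show ?thesis
    unfolding vanishing_ideal_def ideal_gen_def
    by (rule v.subspaceI) (rule m.span_zero m.span_add m.span_scale; assumption)+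
qed

lemma eval_vec_in_span: "eval_vec f \<in> fv.span (unit_vec ` J)"
proof -
  have "eval_vec f = (\<Sum>j\<in>J. (\<lambda>i. eval (a j) f * unit_vec j i))"
    using finite_J by (auto simp: eval_vec_def unit_vec_def sum_apply fun_eq_iff if_distrib cong: if_cong)
  also have "\<dots> \<in> fv.span (unit_vec ` J)"
    by (intro fv.span_sum fv.span_scale fv.span_base) auto
  finally show ?thesis .
qed

lemma hilbert_fun_eq_dim: "hilbert_fun points d = fv.dim (eval_vec ` homog d)"
  unfolding hilbert_fun_def
proof (rule fv.quot_dim_eq_dim_image)
  show "eval_vec (f + g) = eval_vec f + eval_vec g" for f g
    by (auto simp: eval_vec_def eval_add fun_eq_iff)
  show "eval_vec (Const c * f) = (\<lambda>i. c * eval_vec f i)" for c f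
    by (auto simp: eval_vec_def eval_mult eval_Const fun_eq_iff)
  show "u \<in> vanishing_ideal points \<longleftrightarrow> eval_vec u = 0" if "u \<in> homog d" for u
    by (auto simp: homog_in_vanishing_ideal_iff[OF that] eval_vec_def fun_eq_iff)
  show "finite (unit_vec ` J)" using finite_J by simp
  show "eval_vec ` homog d \<subseteq> fv.span (unit_vec ` J)" using eval_vec_in_span by blast
qed (rule subspace_homog subspace_vanishing_ideal)+

lemma inj_unit_vec: "inj unit_vec"
  by (rule injI) (metis unit_vec_def zero_neq_one)

lemma independent_unit_vec: "fv.independent (unit_vec ` J)"
proof (rule fv.independent_if_scalars_zero)
  show "finite (unit_vec ` J)" using finite_J by simp
next
  fix f :: "('i \<Rightarrow> 'k) \<Rightarrow> 'k" and x
  assume 0: "(\<Sum>x\<in>unit_vec ` J. (\<lambda>i. f x * x i)) = 0" and "x \<in> unit_vec ` J"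
  then obtain j where j: "j \<in> J" "x = unit_vec j" by blast
  have "0 = (\<Sum>j\<in>J. (\<lambda>i. f (unit_vec j) * unit_vec j i)) j"
    using 0 inj_unit_vec by (simp add: sum.reindex[OF inj_on_subset[OF inj_unit_vec]])
  also have "\<dots> = f (unit_vec j)"
    using finite_J j by (simp add: sum_apply unit_vec_def if_distrib cong: if_cong)
  finally show "f x = 0" using j by simp
qed

lemma separated_iff_unit_vec: "separated d \<longleftrightarrow> unit_vec ` J \<subseteq> eval_vec ` homog d"
proof -
  have "(\<forall>i\<in>J. eval (a i) g = (if i = j then 1 else 0)) \<longleftrightarrow> unit_vec j = eval_vec g" if "j \<in> J" for g j
    using that by (auto simp: unit_vec_def eval_vec_def fun_eq_iff)
  then show ?thesis by (auto simp: separated_def image_iff subset_iff)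
qed

lemma subspace_eval_vec_homog: "fv.subspace (eval_vec ` homog d)"
proof (rule fv.subspaceI)
  show "0 \<in> eval_vec ` homog d"
    by (rule image_eqI[of _ _ 0]) (auto simp: eval_vec_def eval_zero homog_zero fun_eq_iff)
next
  fix x y assume "x \<in> eval_vec ` homog d" "y \<in> eval_vec ` homog d"
  then obtain f g where *: "f \<in> homog d" "g \<in> homog d" "x = eval_vec f" "y = eval_vec g" by blast
  then show "x + y \<in> eval_vec ` homog d"
    by (intro image_eqI[of _ _ "f + g"]) (auto simp: eval_vec_def eval_add homog_add fun_eq_iff)
next
  fix c x assume "x \<in> eval_vec ` homog d"
  then obtain f where *: "f \<in> homog d" "x = eval_vec f" by blast
  then show "(\<lambda>i. c * x i) \<in> eval_vec ` homog d"
    by (intro image_eqI[of _ _ "Const c * f"])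
      (auto simp: eval_vec_def eval_mult eval_Const homog_Const_mult fun_eq_iff)
qed

lemma hilbert_fun_eq_card_iff: "hilbert_fun points d = card J \<longleftrightarrow> separated d"
proof -
  have card: "card (unit_vec ` J) = card J"
    using inj_unit_vec by (simp add: card_image inj_on_subset)
  show ?thesis
  proof
    assume "hilbert_fun points d = card J"
    moreover obtain B where B: "B \<subseteq> eval_vec ` homog d" "fv.independent B"
      "card B = fv.dim (eval_vec ` homog d)"
      by (rule fv.basis_exists)
    ultimately have cardB: "card B = card J" by (simp add: hilbert_fun_eq_dim)
    have fU: "finite (unit_vec ` J)" using finite_J by simp
    have BU: "B \<subseteq> fv.span (unit_vec ` J)" using B(1) eval_vec_in_span by blast
    have "finite B" using fv.independent_span_bound[OF fU B(2) BU] by simp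
    have "unit_vec ` J \<subseteq> fv.span B"
    proof
      fix x assume x: "x \<in> unit_vec ` J"
      show "x \<in> fv.span B"
      proof (rule ccontr)
        assume notin: "x \<notin> fv.span B"
        then have "fv.independent (insert x B)" using B(2) by (simp add: fv.independent_insert)
        moreover have "insert x B \<subseteq> fv.span (unit_vec ` J)"
          using BU fv.span_base[OF x] by simp
        ultimately have "card (insert x B) \<le> card (unit_vec ` J)"
          using fv.independent_span_bound[OF fU] by blast
        moreover have "x \<notin> B" using notin fv.span_base by blast
        ultimately show False using \<open>finite B\<close> cardB card by simp
      qed
    qed
    also have "fv.span B \<subseteq> eval_vec ` homog d"
      by (rule fv.span_minimal[OF B(1) subspace_eval_vec_homog])
    finally show "separated d" by (simp add: separated_iff_unit_vec)
  next
    assume "separated d"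
    then have "fv.dim (eval_vec ` homog d) = card J"
      using eval_vec_in_span independent_unit_vec card
      by (intro fv.dim_unique[of "unit_vec ` J"]) (auto simp: separated_iff_unit_vec)
    then show "hilbert_fun points d = card J" by (simp add: hilbert_fun_eq_dim)
  qed
qed

text \<open>Point \<open>j\<close> is separated from the others by a product of linear forms \<open>x\<^sub>v - a\<^sub>i\<^sub>v x\<^sub>z\<close>, one
  through each other point \<open>i\<close>; powers of \<open>x\<^sub>z\<close> adjust the degree.\<close>

lemma separated_large:
  assumes "d \<ge> card J"
  shows "separated d"
  unfolding separated_def
proof
  fix j assume j: "j \<in> J"
  have "\<exists>v. a i $ v \<noteq> a j $ v" if "i \<in> J - {j}" for i
    using that j inj_a by (auto simp: vec_eq_iff inj_on_def)
  then obtain v where v: "\<And>i. i \<in> J - {j} \<Longrightarrow> a i $ v i \<noteq> a j $ v i" by metis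
  define h where "h i = Var (v i) + Const (- (a i $ v i)) * Var z" for i
  define g where "g = (\<Prod>i\<in>J - {j}. h i) * Var z ^ (d - card (J - {j}))"
  have le: "card (J - {j}) \<le> d" using assms card_Diff1_le[of J j] by linarith
  have "(\<Prod>i\<in>J - {j}. h i) \<in> homog (\<Sum>i\<in>J - {j}. 1)"
    by (rule homog_prod) (auto simp: h_def intro!: homog_add homog_Const_mult homog_Var[simplified])
  moreover have "Var z ^ k \<in> homog k" for k
    using homog_power[OF homog_Var, of z k] by simp
  ultimately have "g \<in> homog ((\<Sum>i\<in>J - {j}. 1) + (d - card (J - {j})))"
    unfolding g_def by (intro homog_mult)
  then have g: "g \<in> homog d" using le by simp
  have ev: "eval (a k) g = (\<Prod>i\<in>J - {j}. a k $ v i - a i $ v i)" if "k \<in> J" for k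
    using that by (simp add: g_def h_def eval_mult eval_prod eval_add eval_Const eval_Var
        eval_power last_coord)
  have "eval (a j) g \<noteq> 0" using finite_J v by (force simp: ev[OF j])
  moreover have "eval (a k) g = 0" if "k \<in> J" "k \<noteq> j" for k
    using that finite_J by (auto simp: ev[OF that(1)] intro!: bexI[of _ k])
  ultimately show "\<exists>g\<in>homog d. \<forall>i\<in>J. eval (a i) g = (if i = j then 1 else 0)"
    by (intro bexI[of _ "Const (1 / eval (a j) g) * g"])
      (auto simp: eval_mult eval_Const homog_Const_mult g)
qed

lemma separated_ge_socle_degree:
  assumes "d \<ge> socle_degree points"
  shows "separated d"
proof -
  have large: "hilbert_fun points e = card J" if "e \<ge> card J" for e
    using separated_large[OF that] hilbert_fun_eq_card_iff by blast
  have bound: "e \<le> card J" if "hilbert_diff points e \<noteq> 0" for e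
  proof (rule ccontr)
    assume "\<not> e \<le> card J"
    then have "card J \<le> e" "card J \<le> e - 1" "e \<noteq> 0" by linarith+
    then show False
      using that large[of e] large[of "e - 1"] by (simp add: hilbert_diff_def split: if_splits)
  qed
  have step: "hilbert_fun points (Suc e) = hilbert_fun points e" if "e \<ge> d" for e
  proof (rule ccontr)
    assume "\<not> ?thesis"
    then have "hilbert_diff points (Suc e) \<noteq> 0" by (simp add: hilbert_diff_def)
    then have "Suc e \<le> socle_degree points"
      unfolding socle_degree_def by (rule Greatest_le_nat) (rule bound)
    then show False using that assms by simp
  qed
  have "hilbert_fun points (d + k) = hilbert_fun points d" for k
    by (induction k) (simp_all add: step)
  from this[of "card J"] large[of "d + card J"] show ?thesis
    using hilbert_fun_eq_card_iff[of d] by simp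
qed

lemma socle_degree_pos:
  assumes "CARD('v) \<ge> 2" and "\<not> (\<exists>c. c \<noteq> 0 \<and> points \<subseteq> proj_hyperplane c)"
  shows "socle_degree points > 0"
proof (rule ccontr)
  assume "\<not> ?thesis"
  then have sep: "separated 0" by (intro separated_ge_socle_degree) simp
  have "eval b g = coef g 0" if "g \<in> homog 0" for b and g :: "('v, 'k) mpoly"
  proof -
    have "monoms g \<subseteq> {0}"
      using that by (auto simp: homog_def intro!: poly_mapping_eqI)
    then show ?thesis by (subst eval_superset[of "{0}"]) auto
  qed
  then have single: "i = j" if "i \<in> J" "j \<in> J" for i j
    using sep that unfolding separated_def by (metis zero_neq_one)
  have "\<exists>w. w \<noteq> z"
  proof (rule ccontr)
    assume "\<not> ?thesis"
    then have "(UNIV :: 'v set) = {z}" by auto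
    then have "CARD('v) = 1" by (metis card_1_singleton_iff One_nat_def)
    then show False using assms(1) by simp
  qed
  then obtain w where w: "w \<noteq> z" by blast
  obtain b :: "'k ^ 'v" where b: "\<And>i. i \<in> J \<Longrightarrow> a i = b"
    using single by metis
  define c where "c = axis w 1 - (b $ w) *s axis z (1 :: 'k)"
  have "c $ w = 1" using w by (simp add: c_def axis_def)
  then have "c \<noteq> 0" by auto
  moreover have "points \<subseteq> proj_hyperplane c"
  proof
    fix Q assume "Q \<in> points"
    then obtain i where i: "i \<in> J" "Q = proj_point (a i)" by (auto simp: points_def)
    have bz: "b $ z = 1" using b last_coord i(1) by metis
    then have "b \<noteq> 0" by auto
    have "(\<Sum>v\<in>UNIV. c $ v * (k *s b) $ v) =
      (\<Sum>v\<in>UNIV. (if v = w then k * b $ v else 0) - (if v = z then b $ w * (k * b $ v) else 0))" for k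
      by (rule sum.cong) (auto simp: c_def axis_def algebra_simps)
    then have "(\<Sum>v\<in>UNIV. c $ v * (k *s b) $ v) = 0" for k
      by (simp add: sum_subtractf bz)
    then show "Q \<in> proj_hyperplane c"
      using \<open>b \<noteq> 0\<close> b i by (auto simp: proj_hyperplane_def proj_space_def proj_point_def)
  qed
  ultimately show False using assms(2) by blast
qed

end


section \<open>Combinations of divided powers\<close>

lemma submodule_gen_divpow_expansion:
  fixes a :: "'i \<Rightarrow> 'k::field_char_0 ^ 'v::finite"
  assumes J: "finite J"
    and A: "\<And>x. x \<in> A \<Longrightarrow> \<exists>k \<alpha>. x = (\<Sum>i\<in>J. Const (\<alpha> i) * divpow (a i) k)"
    and G: "G \<in> submodule_gen A"
  obtains N c where "G = (\<Sum>d<N::nat. \<Sum>i\<in>J. Const (c d i) * divpow (a i) d)"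
proof -
  interpret m: module "(\<odot>) :: ('v, 'k) mpoly \<Rightarrow> _" by (rule module_diff_act)
  interpret v: vector_space "\<lambda>(c::'k) (g::('v, 'k) mpoly). Const c * g"
    by (rule vector_space_mpoly)
  define D where "D = {divpow (a i) d | i d. i \<in> J}"
  define S where "S = v.span D"
  have act: "f \<odot> x \<in> S" if "x \<in> S" for f x
  proof -
    have "monom_diff m x \<in> S" for m
      using that unfolding S_def
    proof (induction rule: v.span_induct_alt)
      case base
      show ?case using monom_diff_linear(2)[of m 0 "0 :: ('v, 'k) mpoly"] v.span_zero by simp
    next
      case (step c x y)
      from step(1) obtain i d where x: "x = divpow (a i) d" and i: "i \<in> J" by (auto simp: D_def)
      have "divpow (a i) e \<in> v.span D" for e
        using i by (intro v.span_base) (auto simp: D_def)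
      then have "monom_diff m x \<in> v.span D"
        unfolding x monom_diff_divpow by (auto intro!: v.span_zero v.span_scale)
      then show ?case
        using step by (simp only: monom_diff_linear) (intro v.span_add v.span_scale)
    qed
    then show ?thesis unfolding diff_act_def S_def by (intro v.span_sum v.span_scale)
  qed
  have "G \<in> S"
    using G unfolding submodule_gen_def
  proof (induction rule: m.span_induct_alt)
    case base
    show ?case unfolding S_def by (rule v.span_zero)
  next
    case (step f x y)
    obtain k \<alpha> where x: "x = (\<Sum>i\<in>J. Const (\<alpha> i) * divpow (a i) k)" using A[OF step(1)] by blast
    have "x \<in> S" unfolding S_def x by (intro v.span_sum v.span_scale v.span_base) (auto simp: D_def)
    then show ?case using act[of x f] step(2) unfolding S_def by (intro v.span_add)
  qed
  then have "\<exists>N c. G = (\<Sum>d<N::nat. \<Sum>i\<in>J. Const (c d i) * divpow (a i) d)"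
    unfolding S_def
  proof (induction rule: v.span_induct_alt)
    case base
    show ?case by (rule exI[of _ 0]) simp
  next
    case (step b x y)
    from step(2) obtain N c where y: "y = (\<Sum>d<N::nat. \<Sum>i\<in>J. Const (c d i) * divpow (a i) d)" by blast
    obtain j e where x: "x = divpow (a j) e" and j: "j \<in> J" using step(1) by (auto simp: D_def)
    define M where "M = max N (Suc e)"
    define c1 where "c1 d i = (if d < N then c d i else 0)" for d i
    define c2 where "c2 d i = (if d = e \<and> i = j then b else 0)" for d i
    have "y = (\<Sum>d<M. \<Sum>i\<in>J. Const (c1 d i) * divpow (a i) d)"
      unfolding y by (rule sum.mono_neutral_cong_left) (auto simp: M_def c1_def)
    moreover have "Const b * x = (\<Sum>d<M. \<Sum>i\<in>J. Const (c2 d i) * divpow (a i) d)"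
    proof -
      have "(\<Sum>i\<in>J. Const (c2 d i) * divpow (a i) d) = (if d = e then Const b * x else 0)" for d
      proof (cases "d = e")
        case True
        have "(\<Sum>i\<in>J. Const (c2 d i) * divpow (a i) d) = (\<Sum>i\<in>J. if i = j then Const b * x else 0)"
          by (rule sum.cong) (auto simp: c2_def True x)
        then show ?thesis using J j True by simp
      qed (simp add: c2_def)
      then show ?thesis by (simp add: M_def)
    qed
    ultimately have "Const b * x + y =
        (\<Sum>d<M. \<Sum>i\<in>J. Const (c2 d i + c1 d i) * divpow (a i) d)"
      by (simp add: single_add distrib_right sum.distrib)
    then show ?case by (intro exI[of _ M] exI[of _ "\<lambda>d i. c2 d i + c1 d i"])
  qed
  then show ?thesis using that by blast
qed

text \<open>A form of degree \<open>d + 1\<close> divisible by \<open>x\<^sub>z\<close> that separates point \<open>j\<close> from the others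
  kills \<open>G\<close>, but its action on the expansion has constant term \<open>c (d + 1) j\<close>.\<close>

lemma high_coefficients_zero:
  fixes a :: "'i \<Rightarrow> 'k::field_char_0 ^ 'v::finite"
  assumes pts: "affine_points z J a"
    and G: "G = (\<Sum>d<N. \<Sum>i\<in>J. Const (c d i) * divpow (a i) d)" "Var z \<odot> G = 0"
    and sep: "affine_points.separated J a d"
    and "Suc d < N" "j \<in> J"
  shows "c (Suc d) j = 0"
proof -
  interpret affine_points z J a by (rule pts)
  obtain g where g: "g \<in> homog d" "\<And>i. i \<in> J \<Longrightarrow> eval (a i) g = (if i = j then 1 else 0)"
    using sep \<open>j \<in> J\<close> unfolding separated_def by blast
  define h where "h = g * Var z"
  have h: "h \<in> homog (Suc d)" using homog_mult[OF g(1) homog_Var, of z] by (simp add: h_def)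
  have ev: "eval (a i) h = (if i = j then 1 else 0)" if "i \<in> J" for i
    using that by (simp add: h_def eval_mult g eval_Var last_coord)
  have "0 = coef (h \<odot> G) 0"
    by (simp add: h_def diff_act_mult G(2) diff_act_zero_right)
  also have "\<dots> = (\<Sum>e<N. \<Sum>i\<in>J. if e = Suc d then if i = j then c e i else 0 else 0)"
    unfolding G(1) diff_act_sum_right lookup_sum diff_act_Const_mult_right diff_act_divpow[OF h]
    by (intro sum.cong refl) (auto simp: coef_Const_mult coef_divpow_zero ev)
  also have "\<dots> = (\<Sum>e<N. if e = Suc d then c e j else 0)"
    using finite_J \<open>j \<in> J\<close> by (intro sum.cong) auto
  also have "\<dots> = c (Suc d) j" using \<open>Suc d < N\<close> by simp
  finally show ?thesis by simp
qed

theorem proposition3p12: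
  fixes n r s t :: nat
    and z :: "'v::finite"  \<comment> \<open>the index of the last coordinate, so that \<open>x\<^sub>n\<close> is \<open>Var z\<close>\<close>
    and P :: "nat \<Rightarrow> ('k::{alg_closed_field, field_char_0} ^ 'v) set"
    and X :: "('k ^ 'v) set set"
    and a :: "nat \<Rightarrow> 'k ^ 'v"
    and \<alpha> :: "nat \<Rightarrow> 'k"
    and F :: "nat \<Rightarrow> ('v, 'k) mpoly"
  assumes "n \<ge> 1" and "CARD('v) = n + 1"
    and "X = P ` {1..r}" and "inj_on P {1..r}"
    and "X \<subseteq> proj_space - proj_hyperplane (axis z 1)"
    and "\<not> (\<exists>c. c \<noteq> 0 \<and> X \<subseteq> proj_hyperplane c)"
    and "s = socle_degree X"
    and "\<And>i. i \<in> {1..r} \<Longrightarrow> a i \<in> P i \<and> a i $ z = 1"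
    and "\<And>i. i \<in> {1..r} \<Longrightarrow> \<alpha> i \<noteq> 0"
    and "\<And>t. t \<ge> 1 \<Longrightarrow>
      F t = Const (1 / fact (t + s - 1)) * (\<Sum>i=1..r. Const (\<alpha> i) * lin_form (a i) ^ (t + s - 1))"
    and "perp (vanishing_ideal X) = submodule_gen (F ` {1..})"
    and "\<And>t. t > 1 \<Longrightarrow> Var z \<odot> F t = F (t - 1)"
    and "Var z \<odot> F 1 = 0"
    and "t \<ge> s"
  shows "(\<lambda>g. g \<odot> F (t + 1)) ` Ann (F t) = perp (vanishing_ideal X + ideal_gen {Var z})"
proof -
  have P: "P i = proj_point (a i)" if i: "i \<in> {1..r}" for i
  proof -
    have "P i \<in> proj_space" using assms(3,5) i by blast
    then obtain b where b: "P i = proj_point b" by (auto simp: proj_space_def)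
    then obtain k where k: "k \<noteq> 0" "a i = k *s b"
      using assms(8)[OF i] by (auto simp: proj_point_def)
    have "\<exists>c'. c *s b = c' *s a i \<and> c' \<noteq> 0" "\<exists>c'. c *s a i = c' *s b \<and> c' \<noteq> 0" if "c \<noteq> 0" for c
      using k that by (intro exI[of _ "c / k"] exI[of _ "c * k"]; simp add: vec_eq_iff)+
    then show ?thesis
      unfolding b proj_point_def by (intro set_eqI) auto
  qed
  interpret affine_points z "{1..r}" a
  proof
    show "inj_on a {1..r}"
      by (rule inj_onI) (metis P assms(4) inj_onD)
  qed (use assms(8) in auto)
  have X: "X = points" unfolding assms(3) points_def by (rule image_cong[OF refl P])
  have s: "s > 0" using socle_degree_pos assms(1,2,6,7) by (simp add: X)
  have sep: "separated d" if "d \<ge> s" for d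
    using separated_ge_socle_degree that assms(7) by (simp add: X)
  have t: "t \<ge> 1" using s assms(14) by simp
  have F: "F k = (\<Sum>i\<in>{1..r}. Const (\<alpha> i) * divpow (a i) (k + s - 1))" if "k \<ge> 1" for k
    unfolding assms(10)[OF that] divpow_def sum_distrib_left
    by (rule sum.cong) (simp_all only: mult.left_commute)
  have zF: "Var z \<odot> F (t + 1) = F t" using assms(12)[of "t + 1"] t by simp
  interpret pm: module "(*) :: ('v, 'k) mpoly \<Rightarrow> _" by (rule module_mpoly_mult)
  interpret dm: module "(\<odot>) :: ('v, 'k) mpoly \<Rightarrow> _" by (rule module_diff_act)
  have commute: "f \<odot> (g \<odot> G) = g \<odot> (f \<odot> G)" for f g G :: "('v, 'k) mpoly"
    by (metis diff_act_mult mult.commute)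
  have perp_sum: "G \<in> perp (vanishing_ideal X + ideal_gen {Var z}) \<longleftrightarrow>
      G \<in> perp (vanishing_ideal X) \<and> Var z \<odot> G = 0" for G
  proof
    assume G: "G \<in> perp (vanishing_ideal X + ideal_gen {Var z})"
    have "Var z \<in> ideal_gen {Var z :: ('v, 'k) mpoly}" "0 \<in> ideal_gen {Var z :: ('v, 'k) mpoly}" "0 \<in> vanishing_ideal X"
      unfolding vanishing_ideal_def ideal_gen_def
      by (simp_all add: pm.span_zero pm.span_base)
    then have "f \<in> vanishing_ideal X + ideal_gen {Var z}" if "f \<in> vanishing_ideal X \<or> f = Var z" for f
      using that by (metis add_0 add_0_right set_plus_intro)
    then show "G \<in> perp (vanishing_ideal X) \<and> Var z \<odot> G = 0"
      using G by (simp add: perp_def)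
  next
    assume G: "G \<in> perp (vanishing_ideal X) \<and> Var z \<odot> G = 0"
    have "f \<odot> G = 0" if "f \<in> ideal_gen {Var z}" for f
      using that unfolding ideal_gen_def pm.span_singleton
      by (auto simp: diff_act_mult G diff_act_zero_right)
    then show "G \<in> perp (vanishing_ideal X + ideal_gen {Var z})"
      using G by (auto simp: perp_def diff_act_add_left elim!: set_plus_elim)
  qed
  show ?thesis
  proof (intro equalityI subsetI)
    fix G assume "G \<in> (\<lambda>g. g \<odot> F (t + 1)) ` Ann (F t)"
    then obtain g where g: "g \<odot> F t = 0" "G = g \<odot> F (t + 1)" by (auto simp: Ann_def)
    have "F (t + 1) \<in> perp (vanishing_ideal X)"
      unfolding assms(11) submodule_gen_def by (rule dm.span_base) simp
    then have "G \<in> perp (vanishing_ideal X)"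
      unfolding assms(11) submodule_gen_def g(2) by (rule dm.span_scale)
    moreover have "Var z \<odot> G = 0" unfolding g(2) commute[of "Var z"] zF by (rule g(1))
    ultimately show "G \<in> perp (vanishing_ideal X + ideal_gen {Var z})" by (simp add: perp_sum)
  next
    fix G assume "G \<in> perp (vanishing_ideal X + ideal_gen {Var z})"
    then have G: "G \<in> submodule_gen (F ` {1..})" "Var z \<odot> G = 0"
      by (simp_all add: perp_sum assms(11))
    have "\<exists>k \<beta>. x = (\<Sum>i\<in>{1..r}. Const (\<beta> i) * divpow (a i) k)" if "x \<in> F ` {1..}" for x
    proof -
      from that obtain k where "k \<ge> 1" "x = F k" by auto
      then show ?thesis using F[of k] by (intro exI[of _ "k + s - 1"] exI[of _ \<alpha>]) simp
    qed
    from submodule_gen_divpow_expansion[OF finite_J this G(1)]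
    obtain N c where c: "G = (\<Sum>d<N. \<Sum>i\<in>{1..r}. Const (c d i) * divpow (a i) d)" .
    have zero: "c d i = 0" if "s < d" "d < N" "i \<in> {1..r}" for d i
    proof -
      from \<open>s < d\<close> obtain e where e: "d = Suc e" "e \<ge> s" by (cases d) auto
      show ?thesis
        using high_coefficients_zero[OF affine_points_axioms c G(2) sep[OF e(2)] _ that(3)] that(2)
        unfolding e(1) .
    qed
    define b where "b d i = (if d \<le> s then c d i else 0)" for d i
    have b: "c d i = b d i" if "d < N" "i \<in> {1..r}" for d i
      using zero[OF _ that] unfolding b_def by (cases "d \<le> s") simp_all
    have Gb: "G = (\<Sum>d<N. \<Sum>i\<in>{1..r}. Const (b d i) * divpow (a i) d)"
      unfolding c by (intro sum.cong refl) (simp only: b lessThan_iff)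
    define q where "q d j = (SOME g. g \<in> homog d \<and>
      (\<forall>i\<in>{1..r}. eval (a i) g = (if i = j then 1 else 0)))" for d j
    have q: "q d j \<in> homog d \<and> (\<forall>i\<in>{1..r}. eval (a i) (q d j) = (if i = j then 1 else 0))"
      if "d \<ge> s" "j \<in> {1..r}" for d j
    proof -
      have "\<exists>g. g \<in> homog d \<and> (\<forall>i\<in>{1..r}. eval (a i) g = (if i = j then 1 else 0))"
        using sep[OF that(1)] that(2) unfolding separated_def by blast
      from someI_ex[OF this] show ?thesis unfolding q_def .
    qed
    have qF: "q (t + s - d) j \<odot> F (t + 1) = Const (\<alpha> j) * divpow (a j) d"
      if "d \<le> s" "j \<in> {1..r}" for d j
    proof -
      have ge: "t + s - d \<ge> s" using that assms(14) by simp
      have F1: "F (t + 1) = (\<Sum>i\<in>{1..r}. Const (\<alpha> i) * divpow (a i) (t + s))"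
        using F[of "t + 1"] by simp
      have "q (t + s - d) j \<odot> F (t + 1) =
          (\<Sum>i\<in>{1..r}. if i = j then Const (\<alpha> i) * divpow (a i) d else 0)"
        unfolding F1 diff_act_sum_right diff_act_Const_mult_right
          diff_act_divpow[OF conjunct1[OF q[OF ge that(2)]]]
        using that by (intro sum.cong refl) (simp add: q[OF ge that(2)])
      then show ?thesis using that by simp
    qed
    define g where "g = (\<Sum>d<N. \<Sum>i\<in>{1..r}. Const (b d i / \<alpha> i) * q (t + s - d) i)"
    have gF: "g \<odot> F (t + 1) = G"
      unfolding g_def Gb diff_act_sum_left diff_act_Const_mult_left
    proof (intro sum.cong refl)
      fix d i assume i: "i \<in> {1..r}"
      show "Const (b d i / \<alpha> i) * (q (t + s - d) i \<odot> F (t + 1)) = Const (b d i) * divpow (a i) d"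
        using assms(9)[OF i] qF[OF _ i, of d]
        by (cases "d \<le> s") (simp_all add: b_def mult_single flip: mult.assoc)
    qed
    have "g \<odot> F t = Var z \<odot> (g \<odot> F (t + 1))"
      unfolding zF[symmetric] by (rule commute)
    then have "g \<in> Ann (F t)" by (simp only: gF G(2) Ann_def mem_Collect_eq)
    then show "G \<in> (\<lambda>g. g \<odot> F (t + 1)) ` Ann (F t)" unfolding gF[symmetric] by (rule imageI)
  qed
qed

end
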